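(* Let $\mathbf L=(R,\vee,\wedge,{}',0,1)$ be an orthomodular lattice (in particular, any lattice-ordered algebra of $S$-probabilities). Among ring-like structures of events $\mathbf R=(R,\oplus,\cdot,0,1)$ with $\mathbb L(\mathbf R)=\mathbf L$ whose operation $\oplus$ is given by a binary term in $\vee,\wedge,{}'$ (i.e. a term valid as such over orthomodular lattices), there are exactly two, namely those with $x\oplus_1y:=(x\wedge y')\vee(x'\wedge y)$ and $x\oplus_2y:=(x\vee y)\wedge(x'\vee y')$.
   Context: A ring-like structure of events (RLSE) is an algebra $(R,\oplus,\cdot,0,1)$ of type $(2,2,0,0)$ such that $(R,\cdot,1)$ is an idempotent commutative monoid with zero element $0$ (i.e. $x0=0$), satisfying (R1) $x\oplus y= y\oplus x$; (R2) $(xy\oplus1)(x\oplus1)\oplus1= x$; (R3) $((xy\oplus1)x\oplus1)x= xy$; (R4) $xy\oplus(x\oplus1)=(xy\oplus1)x\oplus1$. For such $\mathbf R$, $\mathbb L(\mathbf R):=(R,\vee,\wedge,{}',0,1)$ where $x':=x\oplus1$, $x\wedge y:=xy$, $x\vee y:=(x'y')'$. Equivalently, $\mathbf R$ is an RLSE with $\mathbb L(\mathbf R)=\mathbf L$ iff $xy=x\wedge y$ and $\oplus$ is commutative, satisfies $x\oplus1=x'$, and $x\oplus y=x\vee y$ whenever $x\le y'$.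
   Formalization: "Exactly two" fails when L is Boolean, where the two sums coincide (e.g. the two-element algebra), so they are claimed distinct only for non-distributive L; as terms, they are shown non-identical over orthomodular lattices carried by an arbitrary infinite type. *)

theory Defs
  imports Complex_Main "HOL-Algebra.Ring"
begin

record 'a ortholattice = "'a partial_object" +
  ojoin :: "['a, 'a] \<Rightarrow> 'a" (infixl \<open>\<curlyvee>\<index>\<close> 65)
  omeet :: "['a, 'a] \<Rightarrow> 'a" (infixl \<open>\<curlywedge>\<index>\<close> 70)
  ocompl :: "'a \<Rightarrow> 'a" (\<open>\<sim>\<index> _\<close> [81] 80)
  obot :: 'a
  otop :: 'a

locale orthomodular_lattice =
  fixes L :: "'a ortholattice" (structure)
  assumes join_closed: "\<lbrakk>x \<in> carrier L; y \<in> carrier L\<rbrakk> \<Longrightarrow> x \<curlyvee> y \<in> carrier L"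
    and meet_closed: "\<lbrakk>x \<in> carrier L; y \<in> carrier L\<rbrakk> \<Longrightarrow> x \<curlywedge> y \<in> carrier L"
    and compl_closed: "x \<in> carrier L \<Longrightarrow> \<sim> x \<in> carrier L"
    and bot_closed: "obot L \<in> carrier L"
    and top_closed: "otop L \<in> carrier L"
    and join_comm: "\<lbrakk>x \<in> carrier L; y \<in> carrier L\<rbrakk> \<Longrightarrow> x \<curlyvee> y = y \<curlyvee> x"
    and meet_comm: "\<lbrakk>x \<in> carrier L; y \<in> carrier L\<rbrakk> \<Longrightarrow> x \<curlywedge> y = y \<curlywedge> x"
    and join_assoc: "\<lbrakk>x \<in> carrier L; y \<in> carrier L; z \<in> carrier L\<rbrakk>
          \<Longrightarrow> (x \<curlyvee> y) \<curlyvee> z = x \<curlyvee> (y \<curlyvee> z)"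
    and meet_assoc: "\<lbrakk>x \<in> carrier L; y \<in> carrier L; z \<in> carrier L\<rbrakk>
          \<Longrightarrow> (x \<curlywedge> y) \<curlywedge> z = x \<curlywedge> (y \<curlywedge> z)"
    and join_absorb: "\<lbrakk>x \<in> carrier L; y \<in> carrier L\<rbrakk> \<Longrightarrow> x \<curlyvee> (x \<curlywedge> y) = x"
    and meet_absorb: "\<lbrakk>x \<in> carrier L; y \<in> carrier L\<rbrakk> \<Longrightarrow> x \<curlywedge> (x \<curlyvee> y) = x"
    and bot_least: "x \<in> carrier L \<Longrightarrow> obot L \<curlywedge> x = obot L"
    and top_greatest: "x \<in> carrier L \<Longrightarrow> x \<curlywedge> otop L = x"
    and join_compl: "x \<in> carrier L \<Longrightarrow> x \<curlyvee> \<sim> x = otop L"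
    and meet_compl: "x \<in> carrier L \<Longrightarrow> x \<curlywedge> \<sim> x = obot L"
    and compl_compl: "x \<in> carrier L \<Longrightarrow> \<sim> (\<sim> x) = x"
    and compl_antitone: "\<lbrakk>x \<in> carrier L; y \<in> carrier L; x \<curlywedge> y = x\<rbrakk>
          \<Longrightarrow> \<sim> y \<curlywedge> \<sim> x = \<sim> y"
    and orthomodular: "\<lbrakk>x \<in> carrier L; y \<in> carrier L; x \<curlywedge> y = x\<rbrakk>
          \<Longrightarrow> y = x \<curlyvee> (y \<curlywedge> \<sim> x)"

definition distributive :: "'a ortholattice \<Rightarrow> bool" where
  "distributive L \<longleftrightarrow> (\<forall>x \<in> carrier L. \<forall>y \<in> carrier L. \<forall>z \<in> carrier L.
     x \<curlywedge>\<^bsub>L\<^esub> (y \<curlyvee>\<^bsub>L\<^esub> z) = (x \<curlywedge>\<^bsub>L\<^esub> y) \<curlyvee>\<^bsub>L\<^esub> (x \<curlywedge>\<^bsub>L\<^esub> z))"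

locale rlse = comm_monoid R
  for R :: "'a ring" (structure) +
  assumes add_closed: "\<lbrakk>x \<in> carrier R; y \<in> carrier R\<rbrakk> \<Longrightarrow> x \<oplus> y \<in> carrier R"
    and zero_closed: "\<zero> \<in> carrier R"
    and mult_idem: "x \<in> carrier R \<Longrightarrow> x \<otimes> x = x"
    and mult_zero: "x \<in> carrier R \<Longrightarrow> x \<otimes> \<zero> = \<zero>"
    and R1: "\<lbrakk>x \<in> carrier R; y \<in> carrier R\<rbrakk> \<Longrightarrow> x \<oplus> y = y \<oplus> x"
    and R2: "\<lbrakk>x \<in> carrier R; y \<in> carrier R\<rbrakk>
          \<Longrightarrow> ((x \<otimes> y) \<oplus> \<one>) \<otimes> (x \<oplus> \<one>) \<oplus> \<one> = x"
    and R3: "\<lbrakk>x \<in> carrier R; y \<in> carrier R\<rbrakk>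
          \<Longrightarrow> (((x \<otimes> y) \<oplus> \<one>) \<otimes> x \<oplus> \<one>) \<otimes> x = x \<otimes> y"
    and R4: "\<lbrakk>x \<in> carrier R; y \<in> carrier R\<rbrakk>
          \<Longrightarrow> (x \<otimes> y) \<oplus> (x \<oplus> \<one>) = ((x \<otimes> y) \<oplus> \<one>) \<otimes> x \<oplus> \<one>"

definition lattice_of :: "'a ring \<Rightarrow> 'a ortholattice" where
  "lattice_of R =
     \<lparr>carrier = carrier R,
      ojoin = (\<lambda>x y. ((x \<oplus>\<^bsub>R\<^esub> \<one>\<^bsub>R\<^esub>) \<otimes>\<^bsub>R\<^esub> (y \<oplus>\<^bsub>R\<^esub> \<one>\<^bsub>R\<^esub>)) \<oplus>\<^bsub>R\<^esub> \<one>\<^bsub>R\<^esub>),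
      omeet = (\<lambda>x y. x \<otimes>\<^bsub>R\<^esub> y),
      ocompl = (\<lambda>x. x \<oplus>\<^bsub>R\<^esub> \<one>\<^bsub>R\<^esub>),
      obot = \<zero>\<^bsub>R\<^esub>,
      otop = \<one>\<^bsub>R\<^esub>\<rparr>"

text \<open>
  Equality of algebras: HOL operations are total, so record equality would also compare
  their irrelevant values outside the carrier.
\<close>

definition lattice_eq :: "'a ortholattice \<Rightarrow> 'a ortholattice \<Rightarrow> bool" where
  "lattice_eq L M \<longleftrightarrow>
     carrier L = carrier M \<and> obot L = obot M \<and> otop L = otop M \<and>
     (\<forall>x \<in> carrier L. \<sim>\<^bsub>L\<^esub> x = \<sim>\<^bsub>M\<^esub> x) \<and>
     (\<forall>x \<in> carrier L. \<forall>y \<in> carrier L. x \<curlyvee>\<^bsub>L\<^esub> y = x \<curlyvee>\<^bsub>M\<^esub> y \<and> x \<curlywedge>\<^bsub>L\<^esub> y = x \<curlywedge>\<^bsub>M\<^esub> y)"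

definition ring_eq :: "'a ring \<Rightarrow> 'a ring \<Rightarrow> bool" where
  "ring_eq R S \<longleftrightarrow>
     carrier R = carrier S \<and> \<zero>\<^bsub>R\<^esub> = \<zero>\<^bsub>S\<^esub> \<and> \<one>\<^bsub>R\<^esub> = \<one>\<^bsub>S\<^esub> \<and>
     (\<forall>x \<in> carrier R. \<forall>y \<in> carrier R. x \<oplus>\<^bsub>R\<^esub> y = x \<oplus>\<^bsub>S\<^esub> y \<and> x \<otimes>\<^bsub>R\<^esub> y = x \<otimes>\<^bsub>S\<^esub> y)"

definition rlse_of :: "'a ortholattice \<Rightarrow> 'a ring \<Rightarrow> bool" where
  "rlse_of L R \<longleftrightarrow> rlse R \<and> lattice_eq (lattice_of R) L"

datatype bterm = VarX | VarY | Join bterm bterm | Meet bterm bterm | Compl bterm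

primrec eval :: "'a ortholattice \<Rightarrow> bterm \<Rightarrow> 'a \<Rightarrow> 'a \<Rightarrow> 'a" where
  "eval L VarX x y = x"
| "eval L VarY x y = y"
| "eval L (Join s t) x y = eval L s x y \<curlyvee>\<^bsub>L\<^esub> eval L t x y"
| "eval L (Meet s t) x y = eval L s x y \<curlywedge>\<^bsub>L\<^esub> eval L t x y"
| "eval L (Compl s) x y = \<sim>\<^bsub>L\<^esub> (eval L s x y)"

definition given_by_term :: "'a ortholattice \<Rightarrow> 'a ring \<Rightarrow> bool" where
  "given_by_term L R \<longleftrightarrow>
     (\<exists>t. \<forall>x \<in> carrier L. \<forall>y \<in> carrier L. x \<oplus>\<^bsub>R\<^esub> y = eval L t x y)"

definition ring_with :: "'a ortholattice \<Rightarrow> ('a \<Rightarrow> 'a \<Rightarrow> 'a) \<Rightarrow> 'a ring" where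
  "ring_with L f = \<lparr>carrier = carrier L, mult = (\<lambda>x y. x \<curlywedge>\<^bsub>L\<^esub> y), one = otop L,
     zero = obot L, add = f\<rparr>"

definition oplus1 :: "'a ortholattice \<Rightarrow> 'a \<Rightarrow> 'a \<Rightarrow> 'a" where
  "oplus1 L x y = (x \<curlywedge>\<^bsub>L\<^esub> \<sim>\<^bsub>L\<^esub> y) \<curlyvee>\<^bsub>L\<^esub> (\<sim>\<^bsub>L\<^esub> x \<curlywedge>\<^bsub>L\<^esub> y)"

definition oplus2 :: "'a ortholattice \<Rightarrow> 'a \<Rightarrow> 'a \<Rightarrow> 'a" where
  "oplus2 L x y = (x \<curlyvee>\<^bsub>L\<^esub> y) \<curlywedge>\<^bsub>L\<^esub> (\<sim>\<^bsub>L\<^esub> x \<curlyvee>\<^bsub>L\<^esub> \<sim>\<^bsub>L\<^esub> y)"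

definition term1 :: bterm where
  "term1 = Join (Meet VarX (Compl VarY)) (Meet (Compl VarX) VarY)"

definition term2 :: bterm where
  "term2 = Meet (Join VarX VarY) (Join (Compl VarX) (Compl VarY))"

text \<open>
  The next two notions quantify over all orthomodular lattices whose carrier is a subset of
  the type \<open>'a\<close>.
\<close>

definition oml_identity :: "'a itself \<Rightarrow> bterm \<Rightarrow> bterm \<Rightarrow> bool" where
  "oml_identity T s t \<longleftrightarrow> (\<forall>M :: 'a ortholattice. orthomodular_lattice M \<longrightarrow>
     (\<forall>x \<in> carrier M. \<forall>y \<in> carrier M. eval M s x y = eval M t x y))"

definition rlse_term :: "'a itself \<Rightarrow> bterm \<Rightarrow> bool" where
  "rlse_term T t \<longleftrightarrow> (\<forall>M :: 'a ortholattice. orthomodular_lattice M \<longrightarrow>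
     rlse_of M (ring_with M (eval M t)))"

text \<open>
  Algebras of \<open>S\<close>-probabilities in the sense of Beltrametti and Maczynski, with \<open>S\<close> the
  type \<open>'s\<close>, ordered pointwise; \<open>p\<close> and \<open>q\<close> are orthogonal iff \<open>p \<le> 1 - q\<close>.
\<close>

definition sprob_orth :: "('s \<Rightarrow> real) \<Rightarrow> ('s \<Rightarrow> real) \<Rightarrow> bool" where
  "sprob_orth p q \<longleftrightarrow> p \<le> (\<lambda>s. 1 - q s)"

definition sprob_algebra :: "('s \<Rightarrow> real) set \<Rightarrow> bool" where
  "sprob_algebra P \<longleftrightarrow>
     (\<forall>p \<in> P. \<forall>s. 0 \<le> p s \<and> p s \<le> 1) \<and>
     (\<lambda>s. 0) \<in> P \<and> (\<lambda>s. 1) \<in> P \<and>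
     (\<forall>p \<in> P. (\<lambda>s. 1 - p s) \<in> P) \<and>
     (\<forall>p \<in> P. \<forall>q \<in> P. \<forall>r \<in> P. sprob_orth p q \<and> sprob_orth q r \<and> sprob_orth r p
        \<longrightarrow> (\<lambda>s. p s + q s + r s) \<in> P)"

definition sprob_order :: "('s \<Rightarrow> real) set \<Rightarrow> ('s \<Rightarrow> real) gorder" where
  "sprob_order P = \<lparr>carrier = P, eq = (=), le = (\<le>)\<rparr>"

definition lattice_ordered_sprob_algebra :: "('s \<Rightarrow> real) set \<Rightarrow> bool" where
  "lattice_ordered_sprob_algebra P \<longleftrightarrow> sprob_algebra P \<and> lattice (sprob_order P)"

definition sprob_lattice :: "('s \<Rightarrow> real) set \<Rightarrow> ('s \<Rightarrow> real) ortholattice" where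
  "sprob_lattice P =
     \<lparr>carrier = P,
      ojoin = (\<lambda>p q. p \<squnion>\<^bsub>sprob_order P\<^esub> q),
      omeet = (\<lambda>p q. p \<sqinter>\<^bsub>sprob_order P\<^esub> q),
      ocompl = (\<lambda>p s. 1 - p s),
      obot = (\<lambda>s. 0),
      otop = (\<lambda>s. 1)\<rparr>"

end

theory Submission
  imports Defs
begin

text \<open>In an orthomodular lattice the four atoms \<open>x\<^sup>\<plusminus> \<and> y\<^sup>\<plusminus>\<close> and the commutator of \<open>x\<close> and \<open>y\<close>
  commute with every term in \<open>x\<close>, \<open>y\<close>. Below an atom a term takes only the values of its
  evaluation in the two-element lattice; below the commutator \<open>x, x', y, y'\<close> behave like the atoms
  of \<open>MO2\<close>. Hence a binary term is determined by its values in \<open>2\<close> and in \<open>MO2\<close>. The laws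
  of a ring-like structure of events force the value in \<open>2\<close> to be exclusive or, and
  commutativity of \<open>\<oplus>\<close> at a single non-commuting pair forces the value in \<open>MO2\<close> to be
  \<open>0\<close> (giving \<open>\<oplus>\<^sub>1\<close>) or \<open>1\<close> (giving \<open>\<oplus>\<^sub>2\<close>).\<close>

section \<open>The lattices \<open>2\<close> and \<open>MO2\<close>\<close>

definition bool_lattice :: "bool ortholattice" where
  "bool_lattice = \<lparr>carrier = UNIV, ojoin = (\<or>), omeet = (\<and>), ocompl = Not,
     obot = False, otop = True\<rparr>"

text \<open>The horizontal sum of two four-element Boolean algebras, with the non-commuting
  generators \<open>MX\<close> and \<open>MY\<close>.\<close>

datatype mo2 = MBot | MTop | MX | MX' | MY | MY'

fun mo2_compl :: "mo2 \<Rightarrow> mo2" where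
  "mo2_compl MBot = MTop"
| "mo2_compl MTop = MBot"
| "mo2_compl MX = MX'"
| "mo2_compl MX' = MX"
| "mo2_compl MY = MY'"
| "mo2_compl MY' = MY"

text \<open>The four middle elements are pairwise incomparable, so distinct elements other than
  \<open>MBot\<close> always join to \<open>MTop\<close>.\<close>

definition mo2_join :: "mo2 \<Rightarrow> mo2 \<Rightarrow> mo2" where
  "mo2_join a b = (if a = b then a else if a = MBot then b else if b = MBot then a else MTop)"

text \<open>The De Morgan form lets the meet case of \<open>eval_meet_commutator\<close> reduce to
  joins and complements.\<close>

definition mo2_meet :: "mo2 \<Rightarrow> mo2 \<Rightarrow> mo2" where
  "mo2_meet a b = mo2_compl (mo2_join (mo2_compl a) (mo2_compl b))"

definition mo2_lattice :: "mo2 ortholattice" where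
  "mo2_lattice = \<lparr>carrier = UNIV, ojoin = mo2_join, omeet = mo2_meet, ocompl = mo2_compl,
     obot = MBot, otop = MTop\<rparr>"

lemma UNIV_mo2: "(UNIV :: mo2 set) = {MBot, MTop, MX, MX', MY, MY'}"
  by (auto intro: mo2.exhaust)

lemma orthomodular_lattice_mo2: "orthomodular_lattice mo2_lattice"
proof unfold_locales
  fix x y z :: mo2
  show "(x \<curlyvee>\<^bsub>mo2_lattice\<^esub> y) \<curlyvee>\<^bsub>mo2_lattice\<^esub> z = x \<curlyvee>\<^bsub>mo2_lattice\<^esub> (y \<curlyvee>\<^bsub>mo2_lattice\<^esub> z)"
    by (cases x; cases y; cases z; simp add: mo2_lattice_def mo2_join_def)
  show "(x \<curlywedge>\<^bsub>mo2_lattice\<^esub> y) \<curlywedge>\<^bsub>mo2_lattice\<^esub> z = x \<curlywedge>\<^bsub>mo2_lattice\<^esub> (y \<curlywedge>\<^bsub>mo2_lattice\<^esub> z)"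
    by (cases x; cases y; cases z; simp add: mo2_lattice_def mo2_meet_def mo2_join_def)
  show "x \<curlyvee>\<^bsub>mo2_lattice\<^esub> y = y \<curlyvee>\<^bsub>mo2_lattice\<^esub> x"
    and "x \<curlywedge>\<^bsub>mo2_lattice\<^esub> y = y \<curlywedge>\<^bsub>mo2_lattice\<^esub> x"
    and "x \<curlyvee>\<^bsub>mo2_lattice\<^esub> (x \<curlywedge>\<^bsub>mo2_lattice\<^esub> y) = x"
    and "x \<curlywedge>\<^bsub>mo2_lattice\<^esub> (x \<curlyvee>\<^bsub>mo2_lattice\<^esub> y) = x"
    by (cases x; cases y; simp add: mo2_lattice_def mo2_meet_def mo2_join_def)+
  show "x \<curlywedge>\<^bsub>mo2_lattice\<^esub> y = x \<Longrightarrow>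
      \<sim>\<^bsub>mo2_lattice\<^esub> y \<curlywedge>\<^bsub>mo2_lattice\<^esub> \<sim>\<^bsub>mo2_lattice\<^esub> x = \<sim>\<^bsub>mo2_lattice\<^esub> y"
    and "x \<curlywedge>\<^bsub>mo2_lattice\<^esub> y = x \<Longrightarrow>
      y = x \<curlyvee>\<^bsub>mo2_lattice\<^esub> (y \<curlywedge>\<^bsub>mo2_lattice\<^esub> \<sim>\<^bsub>mo2_lattice\<^esub> x)"
    by (cases x; cases y; simp add: mo2_lattice_def mo2_meet_def mo2_join_def)+
  show "obot mo2_lattice \<curlywedge>\<^bsub>mo2_lattice\<^esub> x = obot mo2_lattice"
    and "x \<curlywedge>\<^bsub>mo2_lattice\<^esub> otop mo2_lattice = x"
    and "x \<curlyvee>\<^bsub>mo2_lattice\<^esub> \<sim>\<^bsub>mo2_lattice\<^esub> x = otop mo2_lattice"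
    and "x \<curlywedge>\<^bsub>mo2_lattice\<^esub> \<sim>\<^bsub>mo2_lattice\<^esub> x = obot mo2_lattice"
    and "\<sim>\<^bsub>mo2_lattice\<^esub> (\<sim>\<^bsub>mo2_lattice\<^esub> x) = x"
    by (cases x; simp add: mo2_lattice_def mo2_meet_def mo2_join_def)+
qed (simp_all add: mo2_lattice_def)

section \<open>The two sums as terms and their values in \<open>2\<close> and
  \<open>MO2\<close>\<close>

lemma oplus1_eq_eval: "oplus1 L = eval L term1"
  by (intro ext) (simp add: oplus1_def term1_def)

lemma oplus2_eq_eval: "oplus2 L = eval L term2"
  by (intro ext) (simp add: oplus2_def term2_def)

lemma eval_bool_lattice_terms:
  "eval bool_lattice term1 i j \<longleftrightarrow> i \<noteq> j" "eval bool_lattice term2 i j \<longleftrightarrow> i \<noteq> j"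
  by (auto simp: term1_def term2_def bool_lattice_def)

text \<open>The two terms agree in \<open>2\<close>, so these values are what tells them apart, both
  in a lattice with a nonzero commutator and as terms.\<close>

lemma eval_mo2_lattice_terms:
  "eval mo2_lattice term1 MX MY = MBot" "eval mo2_lattice term2 MX MY = MTop"
  by (auto simp: term1_def term2_def mo2_lattice_def mo2_meet_def mo2_join_def)

section \<open>Transport along an injection\<close>

text \<open>Needed because \<open>oml_identity\<close> ranges over lattices with elements in one
  fixed type, whereas \<open>mo2_lattice\<close> has a type of its own.\<close>

definition transported :: "('a \<Rightarrow> 'b) \<Rightarrow> 'a ortholattice \<Rightarrow> 'b ortholattice" where
  "transported f L =
     (let g = inv_into (carrier L) f in
      \<lparr>carrier = f ` carrier L,
       ojoin = (\<lambda>x y. f (g x \<curlyvee>\<^bsub>L\<^esub> g y)),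
       omeet = (\<lambda>x y. f (g x \<curlywedge>\<^bsub>L\<^esub> g y)),
       ocompl = (\<lambda>x. f (\<sim>\<^bsub>L\<^esub> g x)),
       obot = f (obot L),
       otop = f (otop L)\<rparr>)"

lemma orthomodular_lattice_transported:
  assumes "orthomodular_lattice L" and inj: "inj_on f (carrier L)"
  shows "orthomodular_lattice (transported f L)"
proof -
  interpret orthomodular_lattice L by fact
  note [simp] = join_closed meet_closed compl_closed bot_closed top_closed
  note [simp] = transported_def Let_def inv_into_f_f[OF inj] inj_on_eq_iff[OF inj]
  show ?thesis
    by unfold_locales
      (auto simp: join_assoc meet_assoc join_absorb meet_absorb bot_least top_greatest
        join_compl meet_compl compl_compl compl_antitone orthomodular[symmetric]
        intro: arg_cong[of _ _ f] join_comm meet_comm)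
qed

text \<open>Membership in the carrier is part of the induction, because \<open>inv_into\<close>
  undoes \<open>f\<close> only there.\<close>

lemma eval_transported:
  assumes "orthomodular_lattice L" and "inj_on f (carrier L)"
    and "x \<in> carrier L" "y \<in> carrier L"
  shows "eval (transported f L) t (f x) (f y) = f (eval L t x y) \<and> eval L t x y \<in> carrier L"
proof -
  interpret orthomodular_lattice L by fact
  show ?thesis
    using assms(2-4)
    by (induction t)
       (auto simp: transported_def Let_def join_closed meet_closed compl_closed)
qed

section \<open>Orthomodular lattices\<close>

context orthomodular_lattice
begin

lemmas closed [simp] = join_closed meet_closed compl_closed bot_closed top_closed

section \<open>Order and De Morgan laws\<close>

definition below :: "'a \<Rightarrow> 'a \<Rightarrow> bool" (infix \<open>\<preceq>\<close> 50) where
  "x \<preceq> y \<longleftrightarrow> x \<curlywedge> y = x"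

lemma meet_idem [simp]: "x \<in> carrier L \<Longrightarrow> x \<curlywedge> x = x"
  by (metis join_absorb meet_absorb meet_closed)

lemma meet_left_comm:
  "\<lbrakk>x \<in> carrier L; y \<in> carrier L; z \<in> carrier L\<rbrakk> \<Longrightarrow> x \<curlywedge> (y \<curlywedge> z) = y \<curlywedge> (x \<curlywedge> z)"
  by (metis meet_assoc meet_comm)

lemma below_refl [simp]: "x \<in> carrier L \<Longrightarrow> x \<preceq> x"
  by (simp add: below_def)

lemma below_trans:
  "\<lbrakk>x \<preceq> y; y \<preceq> z; x \<in> carrier L; y \<in> carrier L; z \<in> carrier L\<rbrakk> \<Longrightarrow> x \<preceq> z"
  unfolding below_def by (metis meet_assoc)

lemma below_antisym: "\<lbrakk>x \<preceq> y; y \<preceq> x; x \<in> carrier L; y \<in> carrier L\<rbrakk> \<Longrightarrow> x = y"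
  unfolding below_def by (metis meet_comm)

lemma meet_below1 [simp]: "\<lbrakk>x \<in> carrier L; y \<in> carrier L\<rbrakk> \<Longrightarrow> x \<curlywedge> y \<preceq> x"
  unfolding below_def by (metis meet_assoc meet_comm meet_idem)

lemma meet_below2 [simp]: "\<lbrakk>x \<in> carrier L; y \<in> carrier L\<rbrakk> \<Longrightarrow> x \<curlywedge> y \<preceq> y"
  unfolding below_def by (metis meet_assoc meet_idem)

lemma meet_greatest:
  "\<lbrakk>z \<preceq> x; z \<preceq> y; x \<in> carrier L; y \<in> carrier L; z \<in> carrier L\<rbrakk> \<Longrightarrow> z \<preceq> x \<curlywedge> y"
  unfolding below_def by (metis meet_assoc)

lemma below_iff_join: "\<lbrakk>x \<in> carrier L; y \<in> carrier L\<rbrakk> \<Longrightarrow> x \<preceq> y \<longleftrightarrow> x \<curlyvee> y = y"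
  unfolding below_def by (metis join_absorb join_comm meet_absorb meet_comm)

lemma below_join1 [simp]: "\<lbrakk>x \<in> carrier L; y \<in> carrier L\<rbrakk> \<Longrightarrow> x \<preceq> x \<curlyvee> y"
  by (simp add: below_def meet_absorb)

lemma below_join2 [simp]: "\<lbrakk>x \<in> carrier L; y \<in> carrier L\<rbrakk> \<Longrightarrow> y \<preceq> x \<curlyvee> y"
  by (metis below_join1 join_comm)

lemma join_least:
  "\<lbrakk>x \<preceq> z; y \<preceq> z; x \<in> carrier L; y \<in> carrier L; z \<in> carrier L\<rbrakk> \<Longrightarrow> x \<curlyvee> y \<preceq> z"
  by (metis below_iff_join join_assoc join_closed)

lemma below_compl: "\<lbrakk>x \<preceq> y; x \<in> carrier L; y \<in> carrier L\<rbrakk> \<Longrightarrow> \<sim> y \<preceq> \<sim> x"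
  unfolding below_def by (rule compl_antitone)

lemma bot_below [simp]: "x \<in> carrier L \<Longrightarrow> obot L \<preceq> x"
  by (simp add: below_def bot_least)

lemma below_top [simp]: "x \<in> carrier L \<Longrightarrow> x \<preceq> otop L"
  by (simp add: below_def top_greatest)

lemma bounds [simp]:
  assumes "x \<in> carrier L"
  shows "obot L \<curlywedge> x = obot L" "x \<curlywedge> obot L = obot L"
    "otop L \<curlywedge> x = x" "x \<curlywedge> otop L = x"
    "obot L \<curlyvee> x = x" "x \<curlyvee> obot L = x"
    "otop L \<curlyvee> x = otop L" "x \<curlyvee> otop L = otop L"
  using assms bot_least top_greatest below_top bot_below
  by (auto simp: meet_comm join_comm below_iff_join)

lemma join_idem [simp]: "x \<in> carrier L \<Longrightarrow> x \<curlyvee> x = x"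
  using below_iff_join below_refl by blast

lemma compl_join:
  assumes "x \<in> carrier L" "y \<in> carrier L"
  shows "\<sim> (x \<curlyvee> y) = \<sim> x \<curlywedge> \<sim> y"
proof (rule below_antisym)
  show "\<sim> (x \<curlyvee> y) \<preceq> \<sim> x \<curlywedge> \<sim> y"
    using assms by (intro meet_greatest below_compl) auto
  have "x \<preceq> \<sim> (\<sim> x \<curlywedge> \<sim> y)" "y \<preceq> \<sim> (\<sim> x \<curlywedge> \<sim> y)"
    using assms below_compl[of "\<sim> x \<curlywedge> \<sim> y" "\<sim> x"] below_compl[of "\<sim> x \<curlywedge> \<sim> y" "\<sim> y"]
    by (auto simp: compl_compl)
  then have "x \<curlyvee> y \<preceq> \<sim> (\<sim> x \<curlywedge> \<sim> y)"
    using assms by (intro join_least) auto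
  from below_compl[OF this] show "\<sim> x \<curlywedge> \<sim> y \<preceq> \<sim> (x \<curlyvee> y)"
    using assms by (simp add: compl_compl)
qed (use assms in auto)

lemma compl_meet:
  assumes "x \<in> carrier L" "y \<in> carrier L"
  shows "\<sim> (x \<curlywedge> y) = \<sim> x \<curlyvee> \<sim> y"
  using assms compl_join[of "\<sim> x" "\<sim> y"] by (metis closed(1) closed(3) compl_compl)

lemma compl_top [simp]: "\<sim> (otop L) = obot L"
  by (metis bounds(3) closed(3) meet_compl top_closed)

lemma compl_bot [simp]: "\<sim> (obot L) = otop L"
  using compl_compl compl_top top_closed by metis

lemma orthomodular_below:
  "\<lbrakk>x \<preceq> y; x \<in> carrier L; y \<in> carrier L\<rbrakk> \<Longrightarrow> x \<curlyvee> (y \<curlywedge> \<sim> x) = y"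
  using orthomodular[of x y] by (simp add: below_def)

text \<open>This is the orthomodular law for \<open>\<sim> y \<preceq> \<sim> x\<close>,
  complemented on both sides.\<close>

lemma orthomodular_dual:
  assumes "x \<preceq> y" "x \<in> carrier L" "y \<in> carrier L"
  shows "y \<curlywedge> (\<sim> y \<curlyvee> x) = x"
proof -
  have "\<sim> y \<curlyvee> (\<sim> x \<curlywedge> \<sim> (\<sim> y)) = \<sim> x"
    using assms by (intro orthomodular_below below_compl) auto
  then have "\<sim> (\<sim> y \<curlyvee> (\<sim> x \<curlywedge> y)) = x"
    using assms by (simp add: compl_compl)
  moreover have "\<sim> (\<sim> y \<curlyvee> (\<sim> x \<curlywedge> y)) = y \<curlywedge> (x \<curlyvee> \<sim> y)"
    using assms by (simp add: compl_compl compl_join compl_meet)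
  ultimately show ?thesis
    using assms by (simp add: join_comm)
qed

lemma eq_if_below_meet_compl_bot:
  assumes "x \<preceq> y" "y \<curlywedge> \<sim> x = obot L" "x \<in> carrier L" "y \<in> carrier L"
  shows "x = y"
  using orthomodular_below[of x y] assms by simp

section \<open>Commuting elements and the Foulis-Holland theorem\<close>

definition commutes :: "'a \<Rightarrow> 'a \<Rightarrow> bool" where
  "commutes x y \<longleftrightarrow> (x \<curlywedge> y) \<curlyvee> (x \<curlywedge> \<sim> y) = x"

lemma commutes_compl2: "\<lbrakk>commutes x y; x \<in> carrier L; y \<in> carrier L\<rbrakk> \<Longrightarrow> commutes x (\<sim> y)"
  by (simp add: commutes_def compl_compl join_comm)

text \<open>Split \<open>x\<close> along \<open>y\<close>: the part below \<open>\<sim> y\<close> is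
  absorbed by \<open>\<sim> y\<close>, and the dual orthomodular law for
  \<open>x \<curlywedge> y \<preceq> y\<close> removes the rest.\<close>

lemma commutes_meet_eq:
  assumes "commutes x y" "x \<in> carrier L" "y \<in> carrier L"
  shows "y \<curlywedge> (\<sim> y \<curlyvee> x) = y \<curlywedge> x"
proof -
  have "\<sim> y \<curlyvee> x = \<sim> y \<curlyvee> ((x \<curlywedge> \<sim> y) \<curlyvee> (x \<curlywedge> y))"
    using assms by (simp add: commutes_def join_comm)
  also have "\<dots> = (\<sim> y \<curlyvee> (x \<curlywedge> \<sim> y)) \<curlyvee> (x \<curlywedge> y)"
    using assms by (simp add: join_assoc)
  also have "\<sim> y \<curlyvee> (x \<curlywedge> \<sim> y) = \<sim> y"
    using assms by (metis closed(3) join_absorb meet_comm)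
  finally show ?thesis
    using assms orthomodular_dual[of "x \<curlywedge> y" y] by (simp add: meet_comm)
qed

text \<open>Complementing the splitting of \<open>x\<close> writes \<open>\<sim> x\<close> as a meet
  of two joins. Meeting with \<open>y\<close> absorbs one of them and leaves
  \<open>y \<curlywedge> \<sim> (y \<curlywedge> x)\<close>, which the orthomodular law joins with
  \<open>y \<curlywedge> x\<close> to give \<open>y\<close>.\<close>

lemma commutes_sym:
  assumes "commutes x y" "x \<in> carrier L" "y \<in> carrier L"
  shows "commutes y x"
proof -
  have "\<sim> ((x \<curlywedge> y) \<curlyvee> (x \<curlywedge> \<sim> y)) = \<sim> x"
    using assms by (simp add: commutes_def)
  then have x': "(\<sim> x \<curlyvee> \<sim> y) \<curlywedge> (\<sim> x \<curlyvee> y) = \<sim> x"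
    using assms by (simp add: compl_compl compl_join compl_meet)
  have "y \<curlywedge> \<sim> x = (y \<curlywedge> (\<sim> x \<curlyvee> y)) \<curlywedge> (\<sim> x \<curlyvee> \<sim> y)"
    using assms by (subst x'[symmetric]) (simp add: meet_assoc meet_comm meet_left_comm)
  also have "y \<curlywedge> (\<sim> x \<curlyvee> y) = y"
    using assms by (metis closed(3) join_comm meet_absorb)
  finally have "y \<curlywedge> \<sim> x = y \<curlywedge> \<sim> (y \<curlywedge> x)"
    using assms by (simp add: compl_meet join_comm)
  then show ?thesis
    using assms orthomodular_below[of "y \<curlywedge> x" y] by (simp add: commutes_def)
qed

lemma commutes_compl1: "\<lbrakk>commutes x y; x \<in> carrier L; y \<in> carrier L\<rbrakk> \<Longrightarrow> commutes (\<sim> x) y"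
  by (meson closed(3) commutes_compl2 commutes_sym)

lemma below_commutes: "\<lbrakk>x \<preceq> y; x \<in> carrier L; y \<in> carrier L\<rbrakk> \<Longrightarrow> commutes x y"
  unfolding commutes_def by (metis below_def closed(2,3) join_absorb)

text \<open>Each of \<open>x\<close> and \<open>y\<close> is the join of its parts below
  \<open>z\<close> and below \<open>\<sim> z\<close>, and these lie below the corresponding parts of
  \<open>x \<curlyvee> y\<close>.\<close>

lemma commutes_join:
  assumes "commutes x z" "commutes y z" "x \<in> carrier L" "y \<in> carrier L" "z \<in> carrier L"
  shows "commutes (x \<curlyvee> y) z"
  unfolding commutes_def
proof (rule below_antisym)
  let ?r = "((x \<curlyvee> y) \<curlywedge> z) \<curlyvee> ((x \<curlyvee> y) \<curlywedge> \<sim> z)"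
  show "?r \<preceq> x \<curlyvee> y"
    using assms by (intro join_least) auto
  have mono: "u \<curlywedge> v \<preceq> (x \<curlyvee> y) \<curlywedge> v"
    if "u \<preceq> x \<curlyvee> y" "u \<in> carrier L" "v \<in> carrier L" for u v
    using that assms by (meson closed below_trans meet_below1 meet_below2 meet_greatest)
  have "u \<preceq> ?r" if u: "u \<preceq> x \<curlyvee> y" "u \<in> carrier L" "commutes u z" for u
  proof -
    have "(u \<curlywedge> z) \<curlyvee> (u \<curlywedge> \<sim> z) \<preceq> ?r"
    proof (rule join_least)
      show "u \<curlywedge> z \<preceq> ?r"
        by (rule below_trans[OF mono]) (use u assms in auto)
      show "u \<curlywedge> \<sim> z \<preceq> ?r"
        by (rule below_trans[OF mono]) (use u assms in auto)
    qed (use u assms in auto)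
    then show ?thesis
      using u by (simp add: commutes_def)
  qed
  then show "x \<curlyvee> y \<preceq> ?r"
    using assms by (intro join_least) auto
qed (use assms in auto)

lemma commutes_meet:
  assumes "commutes x z" "commutes y z" "x \<in> carrier L" "y \<in> carrier L" "z \<in> carrier L"
  shows "commutes (x \<curlywedge> y) z"
proof -
  have "commutes (\<sim> (\<sim> x \<curlyvee> \<sim> y)) z"
    using assms by (intro commutes_compl1 commutes_join) auto
  then show ?thesis
    using assms by (simp add: compl_join compl_compl)
qed

text \<open>One inequality holds in every lattice. By orthomodularity it is an equality once the
  larger side meets the complement of the smaller in \<open>obot L\<close>;
  \<open>commutes_meet_eq\<close> turns that meet into one containing \<open>x \<curlyvee> y\<close>
  and its complement.\<close>

theorem foulis_holland:
  assumes "commutes x z" "commutes y z" "x \<in> carrier L" "y \<in> carrier L" "z \<in> carrier L"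
  shows "(x \<curlyvee> y) \<curlywedge> z = (x \<curlywedge> z) \<curlyvee> (y \<curlywedge> z)"
proof (rule eq_if_below_meet_compl_bot[symmetric])
  show "(x \<curlywedge> z) \<curlyvee> (y \<curlywedge> z) \<preceq> (x \<curlyvee> y) \<curlywedge> z"
    using assms by (intro join_least meet_greatest below_trans[OF meet_below1 below_join1]
        below_trans[OF meet_below1 below_join2]) auto
  have zx: "z \<curlywedge> (\<sim> z \<curlyvee> \<sim> x) = z \<curlywedge> \<sim> x" and zy: "z \<curlywedge> (\<sim> z \<curlyvee> \<sim> y) = z \<curlywedge> \<sim> y"
    using assms by (auto intro: commutes_meet_eq commutes_compl1)
  have "((x \<curlyvee> y) \<curlywedge> z) \<curlywedge> \<sim> ((x \<curlywedge> z) \<curlyvee> (y \<curlywedge> z)) =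
      (x \<curlyvee> y) \<curlywedge> ((z \<curlywedge> (\<sim> z \<curlyvee> \<sim> x)) \<curlywedge> (\<sim> z \<curlyvee> \<sim> y))"
    using assms by (simp add: compl_join compl_meet meet_assoc join_comm)
  also have "\<dots> = (x \<curlyvee> y) \<curlywedge> (\<sim> x \<curlywedge> (z \<curlywedge> (\<sim> z \<curlyvee> \<sim> y)))"
    unfolding zx using assms by (simp add: meet_assoc meet_left_comm[of z "\<sim> x"])
  also have "\<dots> = ((x \<curlyvee> y) \<curlywedge> \<sim> (x \<curlyvee> y)) \<curlywedge> z"
    unfolding zy using assms by (simp add: compl_join meet_assoc meet_comm[of z "\<sim> y"])
  finally show "((x \<curlyvee> y) \<curlywedge> z) \<curlywedge> \<sim> ((x \<curlywedge> z) \<curlyvee> (y \<curlywedge> z)) = obot L"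
    using assms by (simp add: meet_compl)
qed (use assms in auto)

text \<open>The gluing principle: an element commuting with \<open>a\<close> is the join of its
  parts below \<open>a\<close> and below \<open>\<sim> a\<close>.\<close>

lemma eq_by_commuting_parts:
  assumes "commutes s a" "commutes t a" "s \<curlywedge> a = t \<curlywedge> a" "s \<curlywedge> \<sim> a = t \<curlywedge> \<sim> a"
  shows "s = t"
  using assms unfolding commutes_def by metis


section \<open>Binary terms\<close>

lemma eval_closed [simp]:
  "\<lbrakk>x \<in> carrier L; y \<in> carrier L\<rbrakk> \<Longrightarrow> eval L t x y \<in> carrier L"
  by (induction t) auto

text \<open>The elements commuting with \<open>z\<close> are closed under all three
  operations.\<close>

lemma eval_commutes:
  assumes "commutes x z" "commutes y z" "x \<in> carrier L" "y \<in> carrier L" "z \<in> carrier L"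
  shows "commutes (eval L t x y) z"
  using assms by (induction t) (auto intro: commutes_join commutes_meet commutes_compl1)

section \<open>Signed generators, atoms and the commutator\<close>

definition literal :: "bool \<Rightarrow> 'a \<Rightarrow> 'a" where
  "literal i x = (if i then x else \<sim> x)"

text \<open>These four elements are pairwise disjoint. They need not be atoms of \<open>L\<close>
  and may be \<open>obot L\<close>.\<close>

definition atom :: "bool \<Rightarrow> bool \<Rightarrow> 'a \<Rightarrow> 'a \<Rightarrow> 'a" where
  "atom i j x y = literal i x \<curlywedge> literal j y"

text \<open>The complement of the join of the four atoms: what remains of \<open>L\<close> once the
  Boolean part of the pair is removed. It vanishes only for commuting pairs, by
  \<open>commutes_if_commutator_bot\<close>.\<close>

definition commutator :: "'a \<Rightarrow> 'a \<Rightarrow> 'a" where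
  "commutator x y = (x \<curlyvee> y) \<curlywedge> (x \<curlyvee> \<sim> y) \<curlywedge> (\<sim> x \<curlyvee> y) \<curlywedge> (\<sim> x \<curlyvee> \<sim> y)"

lemma literal_closed [simp]: "x \<in> carrier L \<Longrightarrow> literal i x \<in> carrier L"
  by (simp add: literal_def)

lemma atom_closed [simp]: "\<lbrakk>x \<in> carrier L; y \<in> carrier L\<rbrakk> \<Longrightarrow> atom i j x y \<in> carrier L"
  by (simp add: atom_def)

lemma commutator_closed [simp]:
  "\<lbrakk>x \<in> carrier L; y \<in> carrier L\<rbrakk> \<Longrightarrow> commutator x y \<in> carrier L"
  by (simp add: commutator_def)

lemma commutes_if_below_literal:
  assumes "z \<preceq> literal i x" "x \<in> carrier L" "z \<in> carrier L"
  shows "commutes x z"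
proof -
  have "commutes (literal i x) z"
    using assms by (auto intro: commutes_sym[OF below_commutes])
  then show ?thesis
    using assms commutes_compl1[of "\<sim> x" z] by (auto simp: literal_def compl_compl split: if_splits)
qed

lemma commutes_atom:
  assumes "x \<in> carrier L" "y \<in> carrier L"
  shows "commutes x (atom i j x y)" "commutes y (atom i j x y)"
  using assms commutes_if_below_literal[of "atom i j x y" i x]
    commutes_if_below_literal[of "atom i j x y" j y]
  by (auto simp: atom_def)

lemma commutator_eq_atoms:
  assumes "x \<in> carrier L" "y \<in> carrier L"
  shows "commutator x y = \<sim> (atom False False x y) \<curlywedge> \<sim> (atom False True x y)
    \<curlywedge> \<sim> (atom True False x y) \<curlywedge> \<sim> (atom True True x y)"
  using assms by (simp add: commutator_def atom_def literal_def compl_meet compl_compl)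

text \<open>The commutator is a meet of complements of atoms, each of which commutes with
  \<open>x\<close> and \<open>y\<close>.\<close>

lemma commutes_commutator:
  assumes "x \<in> carrier L" "y \<in> carrier L"
  shows "commutes x (commutator x y)" "commutes y (commutator x y)"
proof -
  have "commutes (commutator x y) x" "commutes (commutator x y) y"
    unfolding commutator_eq_atoms[OF assms]
    using assms by (auto intro!: commutes_meet commutes_compl1 commutes_sym[OF commutes_atom(1)]
        commutes_sym[OF commutes_atom(2)])
  then show "commutes x (commutator x y)" "commutes y (commutator x y)"
    using assms by (auto intro: commutes_sym)
qed

lemma commutator_commute:
  "\<lbrakk>x \<in> carrier L; y \<in> carrier L\<rbrakk> \<Longrightarrow> commutator y x = commutator x y"
  by (simp add: commutator_def join_comm meet_assoc meet_comm meet_left_comm)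

lemma commutator_below_join:
  assumes "x \<in> carrier L" "y \<in> carrier L"
  shows "commutator x y \<preceq> x \<curlyvee> y" "commutator x y \<preceq> x \<curlyvee> \<sim> y"
    "commutator x y \<preceq> \<sim> x \<curlyvee> y" "commutator x y \<preceq> \<sim> x \<curlyvee> \<sim> y"
  using assms unfolding commutator_def
  by (auto intro: below_trans[OF meet_below1 meet_below1] below_trans[OF meet_below1 meet_below2]
      below_trans[OF meet_below1 below_trans[OF meet_below1 meet_below1]]
      below_trans[OF meet_below1 below_trans[OF meet_below1 meet_below2]])

text \<open>Each generator either lies above the atom or is disjoint from it, and this alternative
  survives all operations: joins by Foulis-Holland, complements because the value of a term commutes
  with the atom.\<close>

lemma eval_meet_atom:
  assumes "x \<in> carrier L" "y \<in> carrier L"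
  shows "eval L t x y \<curlywedge> atom i j x y =
    (if eval bool_lattice t i j then atom i j x y else obot L)"
proof (induction t)
  case VarX
  then show ?case
    using assms by (simp add: atom_def literal_def meet_assoc[symmetric] meet_compl)
next
  case VarY
  then show ?case
    using assms by (simp add: atom_def literal_def meet_left_comm[of y] meet_compl)
next
  case (Join s t)
  then show ?case
    using assms foulis_holland[of "eval L s x y" "atom i j x y" "eval L t x y"]
    by (simp add: eval_commutes commutes_atom bool_lattice_def)
next
  case (Meet s t)
  then show ?case
    using assms by (simp add: meet_assoc bool_lattice_def)
next
  case (Compl t)
  let ?a = "atom i j x y" and ?t = "eval L t x y"
  have comm: "commutes ?a ?t"
    using assms by (auto intro!: commutes_sym[OF eval_commutes] commutes_atom)
  show ?case
  proof (cases "eval bool_lattice t i j")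
    case True
    then have "?a = ?t \<curlywedge> ?a"
      using Compl by simp
    then have "\<sim> ?t \<curlywedge> ?a = \<sim> ?t \<curlywedge> (?t \<curlywedge> ?a)"
      by simp
    also have "\<dots> = obot L"
      using assms by (simp add: meet_comm[of "\<sim> ?t" ?t] meet_compl flip: meet_assoc)
    finally show ?thesis
      using True by (simp add: bool_lattice_def)
  next
    case False
    then have "?a \<curlywedge> ?t = obot L"
      using Compl assms by (simp add: meet_comm)
    \<comment> \<open>Commutation splits the atom along \<open>?t\<close>; the part below
      \<open>?t\<close> is zero, so the whole atom lies below \<open>\<sim> ?t\<close>.\<close>
    then show ?thesis
      using comm False assms by (simp add: commutes_def bool_lattice_def meet_comm)
  qed
qed

section \<open>Evaluation below the commutator\<close>

text \<open>In general no homomorphism into \<open>L\<close>; it becomes compatible with the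
  operations only after meeting with the commutator.\<close>

primrec mo2_interp :: "'a \<Rightarrow> 'a \<Rightarrow> mo2 \<Rightarrow> 'a" where
  "mo2_interp x y MBot = obot L"
| "mo2_interp x y MTop = otop L"
| "mo2_interp x y MX = x"
| "mo2_interp x y MX' = \<sim> x"
| "mo2_interp x y MY = y"
| "mo2_interp x y MY' = \<sim> y"

lemma mo2_interp_closed [simp]:
  "\<lbrakk>x \<in> carrier L; y \<in> carrier L\<rbrakk> \<Longrightarrow> mo2_interp x y a \<in> carrier L"
  by (cases a) auto

lemma mo2_interp_compl:
  "\<lbrakk>x \<in> carrier L; y \<in> carrier L\<rbrakk> \<Longrightarrow> mo2_interp x y (mo2_compl a) = \<sim> (mo2_interp x y a)"
  by (cases a) (auto simp: compl_compl)

lemma mo2_interp_commutes: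
  assumes "x \<in> carrier L" "y \<in> carrier L"
  shows "commutes (mo2_interp x y a) (commutator x y)"
  using assms commutes_commutator[OF assms]
  by (cases a) (auto intro: commutes_compl1 below_commutes commutes_sym[OF below_commutes[OF below_top]])

text \<open>The commutator lies below every join of a signed \<open>x\<close> with a signed
  \<open>y\<close>, so below it such joins act as the top, just as in \<open>MO2\<close>.\<close>

lemma mo2_interp_join:
  assumes "x \<in> carrier L" "y \<in> carrier L"
  shows "(mo2_interp x y a \<curlyvee> mo2_interp x y b) \<curlywedge> commutator x y =
    mo2_interp x y (mo2_join a b) \<curlywedge> commutator x y"
proof -
  note c = commutator_below_join[OF assms]
  have join_compl': "\<sim> u \<curlyvee> u = otop L" if "u \<in> carrier L" for u
    using that join_compl by (simp add: join_comm)
  have "(x \<curlyvee> y) \<curlywedge> commutator x y = commutator x y"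
    "(x \<curlyvee> \<sim> y) \<curlywedge> commutator x y = commutator x y"
    "(\<sim> x \<curlyvee> y) \<curlywedge> commutator x y = commutator x y"
    "(\<sim> x \<curlyvee> \<sim> y) \<curlywedge> commutator x y = commutator x y"
    "(y \<curlyvee> x) \<curlywedge> commutator x y = commutator x y"
    "(\<sim> y \<curlyvee> x) \<curlywedge> commutator x y = commutator x y"
    "(y \<curlyvee> \<sim> x) \<curlywedge> commutator x y = commutator x y"
    "(\<sim> y \<curlyvee> \<sim> x) \<curlywedge> commutator x y = commutator x y"
    using c assms
    by (simp_all add: below_def meet_comm[of "commutator x y"] join_comm[of y] join_comm[of "\<sim> y"])
  then show ?thesis
    using assms
    by (cases a; cases b; simp add: mo2_join_def join_compl join_compl')
qed

text \<open>For \<open>u\<close> commuting with \<open>z\<close>, the part of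
  \<open>\<sim> u\<close> below \<open>z\<close> is the relative complement of
  \<open>u \<curlywedge> z\<close> in \<open>z\<close>, hence determined by
  \<open>u \<curlywedge> z\<close>.\<close>

lemma compl_meet_cong:
  assumes "s \<curlywedge> z = t \<curlywedge> z" "commutes s z" "commutes t z"
    "s \<in> carrier L" "t \<in> carrier L" "z \<in> carrier L"
  shows "\<sim> s \<curlywedge> z = \<sim> t \<curlywedge> z"
proof -
  have "\<sim> u \<curlywedge> z = z \<curlywedge> \<sim> (u \<curlywedge> z)" if "commutes u z" "u \<in> carrier L" for u
    using that assms commutes_meet_eq[of "\<sim> u" z] commutes_compl1[of u z]
    by (simp add: compl_meet join_comm meet_comm)
  then show ?thesis
    using assms by simp
qed

lemma eval_meet_commutator:
  assumes "x \<in> carrier L" "y \<in> carrier L"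
  shows "eval L t x y \<curlywedge> commutator x y =
    mo2_interp x y (eval mo2_lattice t MX MY) \<curlywedge> commutator x y"
proof (induction t)
  case VarX
  then show ?case by simp
next
  case VarY
  then show ?case by simp
next
  case (Join s t)
  then show ?case
    using assms
    by (simp add: foulis_holland eval_commutes commutes_commutator mo2_interp_commutes
        mo2_lattice_def flip: mo2_interp_join)
next
  case (Meet s t)
  let ?h = "mo2_interp x y" and ?c = "commutator x y"
  let ?a = "eval mo2_lattice s MX MY" and ?b = "eval mo2_lattice t MX MY"
  \<comment> \<open>The meet is treated as the complement of a join of complements, so that
    \<open>mo2_interp_join\<close> applies.\<close>
  have "\<sim> (?h (mo2_compl ?a) \<curlyvee> ?h (mo2_compl ?b)) \<curlywedge> ?c =
      \<sim> (?h (mo2_join (mo2_compl ?a) (mo2_compl ?b))) \<curlywedge> ?c"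
    using assms
    by (intro compl_meet_cong mo2_interp_join commutes_join mo2_interp_commutes) auto
  then have "?h (mo2_meet ?a ?b) \<curlywedge> ?c = (?h ?a \<curlywedge> ?h ?b) \<curlywedge> ?c"
    using assms by (simp add: mo2_meet_def mo2_interp_compl compl_join compl_compl)
  also have "\<dots> = ?h ?a \<curlywedge> (eval L t x y \<curlywedge> ?c)"
    using assms Meet by (simp add: meet_assoc)
  also have "\<dots> = (eval L s x y \<curlywedge> eval L t x y) \<curlywedge> ?c"
    using assms Meet
    by (metis commutator_closed eval_closed meet_assoc meet_left_comm mo2_interp_closed)
  finally show ?case
    by (simp add: mo2_lattice_def)
next
  case (Compl t)
  then have "\<sim> (eval L t x y) \<curlywedge> commutator x y =
      \<sim> (mo2_interp x y (eval mo2_lattice t MX MY)) \<curlywedge> commutator x y"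
    using assms
    by (intro compl_meet_cong eval_commutes commutes_commutator mo2_interp_commutes) auto
  then show ?case
    using assms by (simp add: mo2_interp_compl mo2_lattice_def)
qed

text \<open>Values of terms commute with the atoms, so two terms agree if they agree below each atom
  and below the commutator. The \<open>MO2\<close> condition is vacuous where the commutator
  vanishes.\<close>

theorem eval_eqI:
  assumes "\<And>i j. eval bool_lattice s i j = eval bool_lattice t i j"
    and "commutator x y = obot L \<or> eval mo2_lattice s MX MY = eval mo2_lattice t MX MY"
    and xy: "x \<in> carrier L" "y \<in> carrier L"
  shows "eval L s x y = eval L t x y"
proof -
  let ?s = "eval L s x y" and ?t = "eval L t x y"
  let ?a = "atom False False x y" and ?b = "atom False True x y"
    and ?c = "atom True False x y" and ?d = "atom True True x y"
  have atoms: "?s \<curlywedge> atom i j x y = ?t \<curlywedge> atom i j x y" for i j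
    using assms(1) by (simp add: eval_meet_atom xy)
  have com: "?s \<curlywedge> commutator x y = ?t \<curlywedge> commutator x y"
    using assms(2) xy by (auto simp: eval_meet_commutator)
  have comm: "commutes z (atom i j x y)" if "commutes x z" "commutes y z" "z \<in> carrier L" for i j z
    using that xy
    by - (rule commutes_sym, auto simp: atom_def literal_def intro: commutes_meet commutes_compl1)
  have part: "commutes (eval L u x y \<curlywedge> z) (atom i j x y)"
    if "commutes z (atom i j x y)" "z \<in> carrier L" for i j u z
    using that xy by (intro commutes_meet eval_commutes commutes_atom) auto
  have compl_atom: "commutes (\<sim> (atom i j x y)) (atom i' j' x y)" for i j i' j'
    using xy by (intro commutes_compl1 comm commutes_atom) auto
  have swap: "(?s \<curlywedge> z) \<curlywedge> atom i j x y = (?t \<curlywedge> z) \<curlywedge> atom i j x y" if "z \<in> carrier L" for z i j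
  proof -
    have "(u \<curlywedge> z) \<curlywedge> atom i j x y = (u \<curlywedge> atom i j x y) \<curlywedge> z" if "u \<in> carrier L" for u
      using that xy \<open>z \<in> carrier L\<close> by (simp add: meet_assoc meet_comm meet_left_comm)
    then show ?thesis
      using atoms[of i j] xy by simp
  qed
  \<comment> \<open>The meet with all four complemented atoms is the part below the commutator. The
    atoms \<open>?d\<close>, \<open>?c\<close>, \<open>?b\<close>, \<open>?a\<close> are now put
    back one at a time by gluing.\<close>
  have "?s \<curlywedge> (\<sim> ?a \<curlywedge> \<sim> ?b \<curlywedge> \<sim> ?c) = ?t \<curlywedge> (\<sim> ?a \<curlywedge> \<sim> ?b \<curlywedge> \<sim> ?c)"
  proof (rule eq_by_commuting_parts[of _ ?d])
    show "?s \<curlywedge> (\<sim> ?a \<curlywedge> \<sim> ?b \<curlywedge> \<sim> ?c) \<curlywedge> \<sim> ?d = ?t \<curlywedge> (\<sim> ?a \<curlywedge> \<sim> ?b \<curlywedge> \<sim> ?c) \<curlywedge> \<sim> ?d"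
      using com xy by (simp add: commutator_eq_atoms meet_assoc)
  qed (use xy in \<open>auto intro!: part swap commutes_meet compl_atom\<close>)
  then have "?s \<curlywedge> (\<sim> ?a \<curlywedge> \<sim> ?b) \<curlywedge> \<sim> ?c = ?t \<curlywedge> (\<sim> ?a \<curlywedge> \<sim> ?b) \<curlywedge> \<sim> ?c"
    using xy by (simp add: meet_assoc)
  then have "?s \<curlywedge> (\<sim> ?a \<curlywedge> \<sim> ?b) = ?t \<curlywedge> (\<sim> ?a \<curlywedge> \<sim> ?b)"
    using xy by - (rule eq_by_commuting_parts[of _ ?c],
      auto intro!: part swap commutes_meet compl_atom)
  then have "?s \<curlywedge> \<sim> ?a \<curlywedge> \<sim> ?b = ?t \<curlywedge> \<sim> ?a \<curlywedge> \<sim> ?b"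
    using xy by (simp add: meet_assoc)
  then have "?s \<curlywedge> \<sim> ?a = ?t \<curlywedge> \<sim> ?a"
    using xy by - (rule eq_by_commuting_parts[of _ ?b],
      auto intro!: part swap commutes_meet compl_atom)
  then show ?thesis
    using xy atoms
    by - (rule eq_by_commuting_parts[of _ ?a], auto intro!: eval_commutes commutes_atom)
qed

text \<open>The defining equation of \<open>commutes\<close> is an identity of \<open>2\<close>, so
  it holds wherever there is no \<open>MO2\<close> part.\<close>

lemma commutes_if_commutator_bot:
  assumes "commutator x y = obot L" "x \<in> carrier L" "y \<in> carrier L"
  shows "commutes x y"
proof -
  have "eval L (Join (Meet VarX VarY) (Meet VarX (Compl VarY))) x y = eval L VarX x y"
    using assms by (intro eval_eqI) (auto simp: bool_lattice_def)
  then show ?thesis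
    by (simp add: commutes_def)
qed

lemma distributive_if_commutators_bot:
  assumes "\<And>x y. \<lbrakk>x \<in> carrier L; y \<in> carrier L\<rbrakk> \<Longrightarrow> commutator x y = obot L"
  shows "distributive L"
  unfolding distributive_def
proof (intro ballI)
  fix x y z assume xyz: "x \<in> carrier L" "y \<in> carrier L" "z \<in> carrier L"
  then show "x \<curlywedge> (y \<curlyvee> z) = (x \<curlywedge> y) \<curlyvee> (x \<curlywedge> z)"
    using foulis_holland[of y x z] assms by (simp add: commutes_if_commutator_bot meet_comm)
qed

section \<open>What the laws of the sum force on a term\<close>

text \<open>The bounds form a subalgebra that is an image of \<open>2\<close>, with
  \<open>literal i (otop L)\<close> as the image of \<open>i\<close>.\<close>

lemma eval_bounds:
  "eval L t (literal i (otop L)) (literal j (otop L)) = literal (eval bool_lattice t i j) (otop L)"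
proof -
  have "literal a (otop L) \<curlyvee> literal b (otop L) = literal (a \<or> b) (otop L)"
    "literal a (otop L) \<curlywedge> literal b (otop L) = literal (a \<and> b) (otop L)"
    "\<sim> (literal a (otop L)) = literal (\<not> a) (otop L)" for a b
    by (cases a; cases b; simp add: literal_def)+
  then show ?thesis
    by (induction t) (simp_all add: bool_lattice_def)
qed

text \<open>The hypotheses fix all four values at the bounds, and distinct bounds allow the truth
  value to be read back.\<close>

lemma eval_bool_lattice_eq_xor:
  assumes "\<And>x. x \<in> carrier L \<Longrightarrow> eval L t x (otop L) = \<sim> x"
    and "eval L t (otop L) (obot L) = otop L" "eval L t (obot L) (obot L) = obot L"
    and "obot L \<noteq> otop L"
  shows "eval bool_lattice t i j \<longleftrightarrow> i \<noteq> j"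
proof -
  have "literal (eval bool_lattice t i j) (otop L) = literal (i \<noteq> j) (otop L)"
    unfolding eval_bounds[symmetric] by (cases i; cases j; simp add: literal_def assms(1-3))
  then show ?thesis
    using assms(4) by (cases "eval bool_lattice t i j"; cases i; cases j; simp add: literal_def)
qed

text \<open>If \<open>u\<close> and \<open>v\<close> have the same part below \<open>c\<close>,
  distributing \<open>c\<close> over \<open>u \<curlyvee> v\<close> puts \<open>c\<close> below
  both; yet \<open>c\<close> also lies below \<open>\<sim> (u \<curlywedge> v)\<close>.\<close>

lemma bot_if_meets_eq:
  assumes "u \<curlywedge> c = v \<curlywedge> c" "commutes u c" "commutes v c" "c \<preceq> u \<curlyvee> v" "c \<preceq> \<sim> u \<curlyvee> \<sim> v"
    and "u \<in> carrier L" "v \<in> carrier L" "c \<in> carrier L"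
  shows "c = obot L"
proof -
  have "c = (u \<curlyvee> v) \<curlywedge> c"
    using assms by (simp add: below_def meet_comm)
  also have "\<dots> = v \<curlywedge> c"
    using assms by (simp add: foulis_holland)
  finally have v: "c = v \<curlywedge> c" .
  then have "c = u \<curlywedge> c"
    using assms by simp
  with v have "c = (u \<curlywedge> v) \<curlywedge> c"
    using assms by (metis meet_assoc)
  moreover have "c = \<sim> (u \<curlywedge> v) \<curlywedge> c"
    using assms by (simp add: compl_meet below_def meet_comm)
  ultimately have "c = ((u \<curlywedge> v) \<curlywedge> \<sim> (u \<curlywedge> v)) \<curlywedge> c"
    using assms by (metis closed(2,3) meet_assoc)
  then show ?thesis
    using assms by (simp add: meet_compl)
qed

text \<open>Swapping \<open>x\<close> and \<open>y\<close> keeps the commutator and exchanges the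
  roles of \<open>MX\<close> and \<open>MY\<close>. A middle value would give \<open>x\<close> and
  \<open>y\<close>, or their complements, the same part below a nonzero commutator, against
  \<open>bot_if_meets_eq\<close>.\<close>

lemma eval_mo2_lattice_symmetric:
  assumes sym: "eval L t x y = eval L t y x" and ne: "commutator x y \<noteq> obot L"
    and xy: "x \<in> carrier L" "y \<in> carrier L"
  shows "eval mo2_lattice t MX MY \<in> {MBot, MTop}"
proof -
  let ?m = "eval mo2_lattice t MX MY" and ?c = "commutator x y"
  have "mo2_interp x y ?m \<curlywedge> ?c = mo2_interp y x ?m \<curlywedge> ?c"
    using eval_meet_commutator[of x y t] eval_meet_commutator[of y x t] sym xy
    by (simp add: commutator_commute)
  moreover have "x \<curlywedge> ?c \<noteq> y \<curlywedge> ?c"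
    using bot_if_meets_eq[of x ?c y] ne xy
    by (auto simp: commutes_commutator commutator_below_join)
  moreover have "\<sim> x \<curlywedge> ?c \<noteq> \<sim> y \<curlywedge> ?c"
    using bot_if_meets_eq[of "\<sim> x" ?c "\<sim> y"] ne xy
    by (auto simp: commutes_commutator commutator_below_join compl_compl commutes_compl1)
  ultimately show ?thesis
    by (cases ?m) auto
qed

text \<open>The alternative depends on \<open>t\<close> alone, not on \<open>x\<close> and
  \<open>y\<close>. If the value in \<open>MO2\<close> is a middle element, all commutators vanish
  and the \<open>else\<close> branch is still correct.\<close>

theorem term_sum_cases:
  assumes comm: "\<And>x y. \<lbrakk>x \<in> carrier L; y \<in> carrier L\<rbrakk> \<Longrightarrow> eval L t x y = eval L t y x"
    and compl: "\<And>x. x \<in> carrier L \<Longrightarrow> eval L t x (otop L) = \<sim> x"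
    and bot: "eval L t (obot L) (obot L) = obot L"
    and xy: "x \<in> carrier L" "y \<in> carrier L"
  shows "eval L t x y = (if eval mo2_lattice t MX MY = MTop then oplus2 L x y else oplus1 L x y)"
proof (cases "obot L = otop L")
  \<comment> \<open>In a one-element lattice all terms agree; otherwise the bounds differ and
    determine the value in \<open>2\<close>.\<close>
  case True
  then have "eval L s x y = obot L" for s
    using bounds(1)[OF eval_closed[OF xy]] bounds(3)[OF eval_closed[OF xy]] by simp
  then show ?thesis
    by (simp add: oplus1_eq_eval oplus2_eq_eval)
next
  case False
  have "eval L t (otop L) (obot L) = otop L"
    using comm[of "otop L" "obot L"] compl[of "obot L"] by simp
  then have xor: "eval bool_lattice t i j \<longleftrightarrow> i \<noteq> j" for i j
    using eval_bool_lattice_eq_xor compl bot False by blast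
  have "commutator x y = obot L \<or> eval mo2_lattice t MX MY \<in> {MBot, MTop}"
    using eval_mo2_lattice_symmetric comm xy by blast
  then show ?thesis
    unfolding oplus1_eq_eval oplus2_eq_eval
    using xy by (auto intro!: eval_eqI simp: xor eval_bool_lattice_terms eval_mo2_lattice_terms)
qed

text \<open>Below the commutator the first sum is \<open>obot L\<close> and the second is the whole
  commutator.\<close>

lemma commutator_bot_if_oplus_eq:
  assumes "oplus1 L x y = oplus2 L x y" "x \<in> carrier L" "y \<in> carrier L"
  shows "commutator x y = obot L"
  using assms eval_meet_commutator[of x y term1] eval_meet_commutator[of x y term2]
  by (simp add: oplus1_eq_eval oplus2_eq_eval eval_mo2_lattice_terms)

section \<open>Ring-like structures of events\<close>

text \<open>The lattice form of the axioms: (R2) becomes absorption, (R3) the dual orthomodular law,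
  and (R4) an instance of the rule for orthogonal sums.\<close>

lemma rlse_ofI:
  fixes R :: "'a ring"
  assumes carrier: "carrier R = carrier L" and one: "\<one>\<^bsub>R\<^esub> = otop L" and zero: "\<zero>\<^bsub>R\<^esub> = obot L"
    and mult: "\<And>x y. \<lbrakk>x \<in> carrier L; y \<in> carrier L\<rbrakk> \<Longrightarrow> x \<otimes>\<^bsub>R\<^esub> y = x \<curlywedge> y"
    and closed_add: "\<And>x y. \<lbrakk>x \<in> carrier L; y \<in> carrier L\<rbrakk> \<Longrightarrow> x \<oplus>\<^bsub>R\<^esub> y \<in> carrier L"
    and comm: "\<And>x y. \<lbrakk>x \<in> carrier L; y \<in> carrier L\<rbrakk> \<Longrightarrow> x \<oplus>\<^bsub>R\<^esub> y = y \<oplus>\<^bsub>R\<^esub> x"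
    and compl: "\<And>x. x \<in> carrier L \<Longrightarrow> x \<oplus>\<^bsub>R\<^esub> otop L = \<sim> x"
    and orth: "\<And>x y. \<lbrakk>x \<in> carrier L; y \<in> carrier L; x \<preceq> \<sim> y\<rbrakk> \<Longrightarrow> x \<oplus>\<^bsub>R\<^esub> y = x \<curlyvee> y"
  shows "rlse_of L R"
proof -
  have "rlse R"
  proof unfold_locales
    fix x y assume "x \<in> carrier R" "y \<in> carrier R"
    then have xy: "x \<in> carrier L" "y \<in> carrier L"
      by (simp_all add: carrier)
    show "(x \<otimes>\<^bsub>R\<^esub> y \<oplus>\<^bsub>R\<^esub> \<one>\<^bsub>R\<^esub>) \<otimes>\<^bsub>R\<^esub> (x \<oplus>\<^bsub>R\<^esub> \<one>\<^bsub>R\<^esub>) \<oplus>\<^bsub>R\<^esub> \<one>\<^bsub>R\<^esub> = x"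
      using xy join_absorb[of x y] by (simp add: mult one compl compl_meet[of "\<sim> (x \<curlywedge> y)"] compl_compl join_comm)
    show "((x \<otimes>\<^bsub>R\<^esub> y \<oplus>\<^bsub>R\<^esub> \<one>\<^bsub>R\<^esub>) \<otimes>\<^bsub>R\<^esub> x \<oplus>\<^bsub>R\<^esub> \<one>\<^bsub>R\<^esub>) \<otimes>\<^bsub>R\<^esub> x = x \<otimes>\<^bsub>R\<^esub> y"
      using xy orthomodular_dual[of "x \<curlywedge> y" x]
      by (simp add: mult one compl compl_meet[of x "\<sim> (x \<curlywedge> y)"] compl_compl meet_comm[of _ x])
    \<comment> \<open>The element \<open>x \<curlywedge> y\<close> lies below \<open>x\<close>, so
      it is orthogonal to \<open>\<sim> x\<close> and their sum is a join.\<close>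
    show "x \<otimes>\<^bsub>R\<^esub> y \<oplus>\<^bsub>R\<^esub> (x \<oplus>\<^bsub>R\<^esub> \<one>\<^bsub>R\<^esub>) = (x \<otimes>\<^bsub>R\<^esub> y \<oplus>\<^bsub>R\<^esub> \<one>\<^bsub>R\<^esub>) \<otimes>\<^bsub>R\<^esub> x \<oplus>\<^bsub>R\<^esub> \<one>\<^bsub>R\<^esub>"
      using xy
      by (simp add: mult one compl orth compl_meet[of "\<sim> (x \<curlywedge> y)"] compl_compl)
  qed (auto simp: carrier one zero mult closed_add comm meet_assoc meet_comm meet_left_comm)
  moreover have "lattice_eq (lattice_of R) L"
    unfolding lattice_eq_def lattice_of_def
    by (auto simp: carrier one zero mult compl compl_meet compl_compl)
  ultimately show ?thesis
    by (simp add: rlse_of_def)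
qed

lemma oplus1_orthogonal:
  assumes "x \<preceq> \<sim> y" "x \<in> carrier L" "y \<in> carrier L"
  shows "oplus1 L x y = x \<curlyvee> y"
  using below_compl[of x "\<sim> y"] assms
  by (simp add: oplus1_def below_def compl_compl meet_comm)

lemma oplus2_orthogonal:
  assumes "x \<preceq> \<sim> y" "x \<in> carrier L" "y \<in> carrier L"
  shows "oplus2 L x y = x \<curlyvee> y"
proof -
  have "\<sim> x \<curlyvee> \<sim> y = \<sim> x \<curlyvee> (x \<curlyvee> \<sim> y)"
    using assms by (simp add: below_iff_join)
  also have "\<dots> = otop L"
    using assms join_compl[of x] by (simp add: join_comm[of "\<sim> x" x] flip: join_assoc)
  finally show ?thesis
    using assms by (simp add: oplus2_def)
qed

lemma rlse_of_if_ring_eq_oplus: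
  assumes "ring_eq R (ring_with L (oplus1 L)) \<or> ring_eq R (ring_with L (oplus2 L))"
  shows "rlse_of L R"
  using assms
proof
  assume "ring_eq R (ring_with L (oplus1 L))"
  then show ?thesis
    by (intro rlse_ofI)
      (auto simp: ring_eq_def ring_with_def oplus1_orthogonal, auto simp: oplus1_def join_comm meet_comm)
next
  assume "ring_eq R (ring_with L (oplus2 L))"
  then show ?thesis
    by (intro rlse_ofI)
      (auto simp: ring_eq_def ring_with_def oplus2_orthogonal, auto simp: oplus2_def join_comm meet_comm)
qed

lemma rlse_of_imp_ring_eq:
  assumes R: "rlse_of L R"
    and t: "\<And>x y. \<lbrakk>x \<in> carrier L; y \<in> carrier L\<rbrakk> \<Longrightarrow> x \<oplus>\<^bsub>R\<^esub> y = eval L t x y"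
  shows "ring_eq R (ring_with L
    (if eval mo2_lattice t MX MY = MTop then oplus2 L else oplus1 L))"
proof -
  interpret R: rlse R
    using R by (simp add: rlse_of_def)
  have "lattice_eq (lattice_of R) L"
    using R by (simp add: rlse_of_def)
  then have carrier: "carrier R = carrier L" and zero: "\<zero>\<^bsub>R\<^esub> = obot L" and one: "\<one>\<^bsub>R\<^esub> = otop L"
    and mult: "\<And>x y. \<lbrakk>x \<in> carrier L; y \<in> carrier L\<rbrakk> \<Longrightarrow> x \<otimes>\<^bsub>R\<^esub> y = x \<curlywedge> y"
    and compl: "\<And>x. x \<in> carrier L \<Longrightarrow> x \<oplus>\<^bsub>R\<^esub> otop L = \<sim> x"
    by (auto simp: lattice_eq_def lattice_of_def)
  \<comment> \<open>At these arguments the left side of (R4) is the sum of two zeros and the right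
    side is the complement of the top.\<close>
  have "obot L \<oplus>\<^bsub>R\<^esub> obot L = obot L"
    using R.R4[of "\<one>\<^bsub>R\<^esub>" "\<zero>\<^bsub>R\<^esub>"] by (simp add: carrier zero one mult compl)
  moreover have "x \<oplus>\<^bsub>R\<^esub> y = y \<oplus>\<^bsub>R\<^esub> x" if "x \<in> carrier L" "y \<in> carrier L" for x y
    using that R.R1 by (simp add: carrier)
  ultimately have "eval L t x y =
      (if eval mo2_lattice t MX MY = MTop then oplus2 L x y else oplus1 L x y)"
    if "x \<in> carrier L" "y \<in> carrier L" for x y
    using that compl by (intro term_sum_cases) (simp_all flip: t)
  then show ?thesis
    by (auto simp: ring_eq_def ring_with_def carrier zero one mult t)
qed

lemma rlse_of_term_iff:
  "rlse_of L R \<and> given_by_term L R \<longleftrightarrow>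
    ring_eq R (ring_with L (oplus1 L)) \<or> ring_eq R (ring_with L (oplus2 L))"
proof
  assume R: "rlse_of L R \<and> given_by_term L R"
  then obtain t where "\<forall>x \<in> carrier L. \<forall>y \<in> carrier L. x \<oplus>\<^bsub>R\<^esub> y = eval L t x y"
    unfolding given_by_term_def by blast
  then show "ring_eq R (ring_with L (oplus1 L)) \<or> ring_eq R (ring_with L (oplus2 L))"
    using R rlse_of_imp_ring_eq[of R t] by (simp split: if_splits)
next
  assume R: "ring_eq R (ring_with L (oplus1 L)) \<or> ring_eq R (ring_with L (oplus2 L))"
  then have "given_by_term L R"
    unfolding given_by_term_def ring_eq_def ring_with_def oplus1_eq_eval oplus2_eq_eval
    by auto
  with R show "rlse_of L R \<and> given_by_term L R"
    using rlse_of_if_ring_eq_oplus by blast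
qed

lemma distributive_if_oplus_eq:
  assumes "ring_eq (ring_with L (oplus1 L)) (ring_with L (oplus2 L))"
  shows "distributive L"
  using assms
  by (intro distributive_if_commutators_bot commutator_bot_if_oplus_eq)
     (auto simp: ring_eq_def ring_with_def)

end

text \<open>The value of \<open>t\<close> in \<open>MO2\<close> does not depend on \<open>M\<close>,
  so the same one of the two terms serves for all lattices at once.\<close>

lemma rlse_term_iff:
  "rlse_term TYPE('a) t \<longleftrightarrow> oml_identity TYPE('a) t term1 \<or> oml_identity TYPE('a) t term2"
proof
  assume t: "rlse_term TYPE('a) t"
  have *: "eval M t x y = (if eval mo2_lattice t MX MY = MTop then oplus2 M x y else oplus1 M x y)"
    if "orthomodular_lattice M" "x \<in> carrier M" "y \<in> carrier M" for M :: "'a ortholattice" and x y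
  proof -
    interpret orthomodular_lattice M by fact
    have "rlse_of M (ring_with M (eval M t))"
      using t that by (simp add: rlse_term_def)
    from rlse_of_imp_ring_eq[OF this, of t] show ?thesis
      using that by (auto simp: ring_with_def ring_eq_def split: if_splits)
  qed
  show "oml_identity TYPE('a) t term1 \<or> oml_identity TYPE('a) t term2"
    using * by (cases "eval mo2_lattice t MX MY = MTop")
      (simp_all add: oml_identity_def oplus1_eq_eval oplus2_eq_eval)
next
  assume t: "oml_identity TYPE('a) t term1 \<or> oml_identity TYPE('a) t term2"
  show "rlse_term TYPE('a) t"
    unfolding rlse_term_def
  proof (intro allI impI)
    fix M :: "'a ortholattice" assume "orthomodular_lattice M"
    then interpret orthomodular_lattice M .
    have "ring_eq (ring_with M (eval M t)) (ring_with M (oplus1 M)) \<or>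
        ring_eq (ring_with M (eval M t)) (ring_with M (oplus2 M))"
      using t \<open>orthomodular_lattice M\<close>
      by (auto simp: oml_identity_def ring_eq_def ring_with_def oplus1_eq_eval oplus2_eq_eval)
    then show "rlse_of M (ring_with M (eval M t))"
      by (rule rlse_of_if_ring_eq_oplus)
  qed
qed

text \<open>An infinite type contains a copy of \<open>MO2\<close>, where the terms take the values
  \<open>MBot\<close> and \<open>MTop\<close> at the generators.\<close>

lemma terms_not_identical:
  assumes "infinite (UNIV :: 'a set)"
  shows "\<not> oml_identity TYPE('a) term1 term2"
proof
  assume identity: "oml_identity TYPE('a) term1 term2"
  have "finite (UNIV :: mo2 set)"
    by (simp add: UNIV_mo2)
  then obtain f :: "mo2 \<Rightarrow> 'a" where f: "inj f"
    using infinite_arbitrarily_large[OF assms] card_le_inj by (metis order_refl)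
  have "inj_on f (carrier mo2_lattice)"
    using f by (simp add: mo2_lattice_def)
  note f' = orthomodular_lattice_mo2 this
  have mem: "MX \<in> carrier mo2_lattice" "MY \<in> carrier mo2_lattice"
    by (simp_all add: mo2_lattice_def)
  then have "f MX \<in> carrier (transported f mo2_lattice)" "f MY \<in> carrier (transported f mo2_lattice)"
    by (simp_all add: transported_def Let_def)
  then have "eval (transported f mo2_lattice) term1 (f MX) (f MY) =
      eval (transported f mo2_lattice) term2 (f MX) (f MY)"
    using identity orthomodular_lattice_transported[OF f'] by (simp add: oml_identity_def)
  then have "f MBot = f MTop"
    using eval_transported[OF f' mem] by (simp add: eval_mo2_lattice_terms)
  then show False
    using f by (simp add: inj_eq)
qed

section \<open>Algebras of \<open>S\<close>-probabilities\<close>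

lemma sprob_algebra_range:
  "\<lbrakk>sprob_algebra P; p \<in> P\<rbrakk> \<Longrightarrow> 0 \<le> p s" "\<lbrakk>sprob_algebra P; p \<in> P\<rbrakk> \<Longrightarrow> p s \<le> 1"
  by (auto simp: sprob_algebra_def)

lemma sprob_algebra_compl: "\<lbrakk>sprob_algebra P; p \<in> P\<rbrakk> \<Longrightarrow> (\<lambda>s. 1 - p s) \<in> P"
  by (simp add: sprob_algebra_def)

text \<open>The orthogonal triple \<open>r, p, 1 - p\<close> has sum \<open>1 + r\<close>, which must not exceed \<open>1\<close>.\<close>

lemma sprob_algebra_disjoint:
  assumes "sprob_algebra P" "p \<in> P" "r \<in> P" "r \<le> p" "r \<le> (\<lambda>s. 1 - p s)"
  shows "r = (\<lambda>s. 0)"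
proof -
  have "(\<lambda>s. 1 - p s) \<in> P"
    using assms by (simp add: sprob_algebra_compl)
  moreover have "sprob_orth r p" "sprob_orth p (\<lambda>s. 1 - p s)" "sprob_orth (\<lambda>s. 1 - p s) r"
    using assms by (auto simp: sprob_orth_def le_fun_def)
  ultimately have "(\<lambda>s. r s + p s + (1 - p s)) \<in> P"
    using assms(1-3) unfolding sprob_algebra_def by blast
  note sprob_algebra_range(2)[OF assms(1) this] sprob_algebra_range(1)[OF assms(1,3)]
  then show ?thesis
    by (intro ext order_antisym) simp_all
qed

text \<open>The orthogonal triple \<open>p\<close>, \<open>1 - q\<close>, \<open>0\<close> has as
  its sum the complement of \<open>q - p\<close>.\<close>

lemma sprob_algebra_diff:
  assumes "sprob_algebra P" "p \<in> P" "q \<in> P" "p \<le> q"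
  shows "(\<lambda>s. q s - p s) \<in> P"
proof -
  have P: "(\<lambda>s. 0) \<in> P" "(\<lambda>s. 1 - q s) \<in> P" "\<And>s. 0 \<le> q s" "\<And>s. p s \<le> 1"
    using assms by (auto simp: sprob_algebra_def)
  moreover have "sprob_orth p (\<lambda>s. 1 - q s)" "sprob_orth (\<lambda>s. 1 - q s) (\<lambda>s. 0)" "sprob_orth (\<lambda>s. 0) p"
    using assms P by (auto simp: sprob_orth_def le_fun_def)
  ultimately have "(\<lambda>s. p s + (1 - q s) + 0) \<in> P"
    using assms(1,2) unfolding sprob_algebra_def by blast
  from sprob_algebra_compl[OF assms(1) this] show ?thesis
    by (simp add: algebra_simps)
qed

text \<open>The orthogonal triple \<open>p\<close>, \<open>q - p\<close>, \<open>1 - z\<close> has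
  sum \<open>1 + q - z\<close>, which must not exceed \<open>1\<close>. Thus \<open>q\<close> is the
  least upper bound of \<open>p\<close> and \<open>q - p\<close> in \<open>P\<close>, which yields
  orthomodularity.\<close>

lemma sprob_algebra_diff_least:
  assumes "sprob_algebra P" "p \<in> P" "q \<in> P" "z \<in> P" "p \<le> q" "p \<le> z" "(\<lambda>s. q s - p s) \<le> z"
  shows "q \<le> z"
proof -
  have "(\<lambda>s. q s - p s) \<in> P" "(\<lambda>s. 1 - z s) \<in> P" "\<And>s. q s \<le> 1"
    using assms by (auto simp: sprob_algebra_diff) (auto simp: sprob_algebra_def)
  moreover from this have "sprob_orth p (\<lambda>s. q s - p s)" "sprob_orth (\<lambda>s. q s - p s) (\<lambda>s. 1 - z s)"
    "sprob_orth (\<lambda>s. 1 - z s) p"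
    using assms by (auto simp: sprob_orth_def le_fun_def)
  ultimately have "(\<lambda>s. p s + (q s - p s) + (1 - z s)) \<in> P"
    using assms(1,2) unfolding sprob_algebra_def by blast
  from sprob_algebra_range(2)[OF assms(1) this] show ?thesis
    by (simp add: le_fun_def)
qed

lemma orthomodular_lattice_sprob:
  assumes "lattice_ordered_sprob_algebra P"
  shows "orthomodular_lattice (sprob_lattice P)"
proof -
  have P: "sprob_algebra P" and "lattice (sprob_order P)"
    using assms by (simp_all add: lattice_ordered_sprob_algebra_def)
  then interpret Lat: lattice "sprob_order P" by simp
  have carrier [simp]: "carrier (sprob_order P) = P" and le [simp]: "le (sprob_order P) = (\<le>)"
    by (simp_all add: sprob_order_def)
  let ?J = "\<lambda>p q. p \<squnion>\<^bsub>sprob_order P\<^esub> q" and ?M = "\<lambda>p q. p \<sqinter>\<^bsub>sprob_order P\<^esub> q"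
  have J: "?J p q \<in> P" "p \<le> ?J p q" "q \<le> ?J p q" if "p \<in> P" "q \<in> P" for p q
    using that Lat.join_closed[of p q] Lat.join_left[of p q] Lat.join_right[of p q] by simp_all
  have J_least: "?J p q \<le> z" if "p \<in> P" "q \<in> P" "z \<in> P" "p \<le> z" "q \<le> z" for p q z
    using that Lat.join_le[of p z q] by simp
  have M: "?M p q \<in> P" "?M p q \<le> p" "?M p q \<le> q" if "p \<in> P" "q \<in> P" for p q
    using that Lat.meet_closed[of p q] Lat.meet_left[of p q] Lat.meet_right[of p q] by simp_all
  have M_greatest: "z \<le> ?M p q" if "p \<in> P" "q \<in> P" "z \<in> P" "z \<le> p" "z \<le> q" for p q z
    using that Lat.meet_le[of z p q] by simp
  have M_eq: "?M p q = p \<longleftrightarrow> p \<le> q" if "p \<in> P" "q \<in> P" for p q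
    using that M[of p q] M_greatest[of p q p] by (metis order_antisym order_refl)
  have C: "(\<lambda>s. 1 - p s) \<in> P" if "p \<in> P" for p
    using P that by (simp add: sprob_algebra_compl)
  have bounds: "(\<lambda>s. 0) \<in> P" "(\<lambda>s. 1) \<in> P" "\<And>p. p \<in> P \<Longrightarrow> (\<lambda>s. 0) \<le> p"
    "\<And>p. p \<in> P \<Longrightarrow> p \<le> (\<lambda>s. 1)"
    using P by (auto simp: sprob_algebra_def le_fun_def)
  show ?thesis
    unfolding sprob_lattice_def
  proof (unfold_locales, simp_all only: ortholattice.simps partial_object.simps)
    fix x y z assume xyz: "x \<in> P" "y \<in> P" "z \<in> P"
    show "?J (?J x y) z = ?J x (?J y z)"
      using xyz Lat.join_assoc[of x y z] by simp
    show "?M (?M x y) z = ?M x (?M y z)"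
      using xyz Lat.meet_assoc[of x y z] by simp
  next
    fix x y assume xy: "x \<in> P" "y \<in> P"
    show "?J x y \<in> P" "?M x y \<in> P"
      using xy J M by blast+
    show "?J x y = ?J y x"
      using xy J by (intro order_antisym J_least) auto
    show "?M x y = ?M y x"
      using xy M by (intro order_antisym M_greatest) auto
    show "?J x (?M x y) = x"
      using xy J M by (intro order_antisym J_least) auto
    show "?M x (?J x y) = x"
      using xy J by (simp add: M_eq)
    assume "?M x y = x"
    then have le: "x \<le> y"
      using xy by (simp add: M_eq)
    show "?M (\<lambda>s. 1 - y s) (\<lambda>s. 1 - x s) = (\<lambda>s. 1 - y s)"
      using le xy C by (simp add: M_eq le_fun_def)
    let ?D = "\<lambda>s. y s - x s" and ?N = "?M y (\<lambda>s. 1 - x s)"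
    have D: "?D \<in> P"
      using P xy le by (simp add: sprob_algebra_diff)
    have N: "?N \<in> P" "?N \<le> y"
      using M[OF xy(2) C[OF xy(1)]] by auto
    \<comment> \<open>An upper bound of \<open>x\<close> and \<open>?N\<close> is then one of
      \<open>x\<close> and \<open>?D\<close>, hence lies above \<open>y\<close>.\<close>
    have "?D \<le> ?N"
      using D C xy bounds(3)[OF xy(1)] bounds(4)[OF xy(2)]
      by (intro M_greatest) (auto simp: le_fun_def)
    then have "y \<le> ?J x ?N"
      using J[OF xy(1) N(1)] le xy
      by (intro sprob_algebra_diff_least[OF P xy(1) xy(2)]) (auto intro: order_trans)
    moreover have "?J x ?N \<le> y"
      using N le xy by (intro J_least) auto
    ultimately show "y = ?J x ?N"
      by (rule order_antisym)
  next
    fix x assume x: "x \<in> P"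
    show "(\<lambda>s. 1 - x s) \<in> P" "(\<lambda>s. 1 - (1 - x s)) = x"
      using x C by auto
    show "?M (\<lambda>s. 0) x = (\<lambda>s. 0)" "?M x (\<lambda>s. 1) = x"
      using x bounds by (simp_all add: M_eq)
    show "?M x (\<lambda>s. 1 - x s) = (\<lambda>s. 0)"
      using M[OF x C[OF x]] sprob_algebra_disjoint[OF P x] by blast
    let ?j = "?J x (\<lambda>s. 1 - x s)"
    have j: "?j \<in> P" "x \<le> ?j" "(\<lambda>s. 1 - x s) \<le> ?j"
      using J[OF x C[OF x]] by auto
    \<comment> \<open>The complement of the join lies below both \<open>x\<close> and its
      complement, so the disjointness of these two makes it zero.\<close>
    have "(\<lambda>s. 1 - ?j s) = (\<lambda>s. 0)"
    proof (rule sprob_algebra_disjoint[OF P x C])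
      show "(\<lambda>s. 1 - ?j s) \<le> x"
        using j(3) by (simp add: le_fun_def algebra_simps)
      show "(\<lambda>s. 1 - ?j s) \<le> (\<lambda>s. 1 - x s)"
        using j(2) by (simp add: le_fun_def)
    qed (rule j(1))
    then show "?j = (\<lambda>s. 1)"
      by (simp add: fun_eq_iff)
  qed (use bounds in auto)
qed

theorem theorem3p2:
  fixes L :: "'a ortholattice"
  assumes "orthomodular_lattice L"
  shows
    "(\<forall>R. rlse_of L R \<and> given_by_term L R \<longleftrightarrow>
        ring_eq R (ring_with L (oplus1 L)) \<or> ring_eq R (ring_with L (oplus2 L))) \<and>
     (\<not> distributive L \<longrightarrow> \<not> ring_eq (ring_with L (oplus1 L)) (ring_with L (oplus2 L))) \<and>
     (\<forall>t. rlse_term TYPE('a) t \<longleftrightarrow>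
        oml_identity TYPE('a) t term1 \<or> oml_identity TYPE('a) t term2) \<and>
     (infinite (UNIV :: 'a set) \<longrightarrow> \<not> oml_identity TYPE('a) term1 term2) \<and>
     (\<forall>P :: ('s \<Rightarrow> real) set. lattice_ordered_sprob_algebra P \<longrightarrow>
        orthomodular_lattice (sprob_lattice P))"
proof -
  interpret orthomodular_lattice L by fact
  show ?thesis
    using rlse_of_term_iff distributive_if_oplus_eq rlse_term_iff terms_not_identical
      orthomodular_lattice_sprob by blast
qed

end
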